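(* Let $h:\mathbb{R}^n\to\overline{\mathbb{R}}$ be proper, and let $\overline{x}\in\arg\min_{\mathbb{R}^n}h$. (a) If $h$ is $\kappa$-quasar-convex with respect to $\overline{x}$, where $\kappa\in(0,1]$, then every Dini-stationary point of $h$ is a global minimizer, i.e., $\mathrm{Dcrit}(h)\subseteq\arg\min_{\mathbb{R}^n}h$. Consequently, $h$ has no saddle points in the Dini sense. (b) If $h$ is $(\kappa,\gamma)$-strongly quasar-convex with respect to $\overline{x}$ with $\kappa\in(0,1]$ and $\gamma>0$, then $\mathrm{Dcrit}(h)=\{\overline{x}\}$, that is, the unique stationary point is the unique global minimizer.
   Context: $\overline{\mathbb{R}}=\mathbb{R}\cup\{+\infty\}$; $\mathrm{dom}(h)=\{x:h(x)<+\infty\}$; $h$ is proper if $\mathrm{dom}(h)\neq\emptyset$; $\|\cdot\|$ is the Euclidean norm. Let $\kappa\in(0,1]$, $\gamma\ge 0$. A proper function $h:\mathbb{R}^n\to\overline{\mathbb{R}}$ with convex domain and $\arg\min_{\mathbb{R}^n}h\neq\emptyset$ is called $(\kappa,\gamma)$-strongly quasar-convex with respect to $\overline{x}\in\arg\min_{\mathbb{R}^n}h$ if for all $x\in\mathrm{dom}(h)$ and all $\lambda\in[0,1]$, $$h(\lambda\overline{x}+(1-\lambda)x)\le\kappa\lambda h(\overline{x})+(1-\kappa\lambda)h(x)-\lambda\left(1-\frac{\lambda}{2-\kappa}\right)\frac{\kappa\gamma}{2}\|x-\overline{x}\|^2.$$ If $\gamma=0$, $h$ is called $\kappa$-quasar-convex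 with respect to $\overline{x}$. For $x\in\mathrm{dom}(h)$ and $d\in\mathbb{R}^n$, the lower Dini directional derivative is $h^{D-}(x;d):=\liminf_{t\downarrow 0}\frac{h(x+td)-h(x)}{t}$. A point $x\in\mathrm{dom}(h)$ is Dini-stationary if $h^{D-}(x;d)\ge 0$ for all $d\in\mathbb{R}^n$; $\mathrm{Dcrit}(h)$ is the set of all such points. A saddle point in the Dini sense is a Dini-stationary point that is neither a local minimizer nor a local maximizer. *)

theory Defs
  imports "HOL-Analysis.Analysis"
begin

definition effdom :: "('a \<Rightarrow> ereal) \<Rightarrow> 'a set" where
  "effdom h = {x. h x < \<infinity>}"

(* Functions into \<real> \<union> {+\<infinity>} are ereal-valued functions that never take the value -\<infinity>;
   this codomain restriction is part of properness here. *)
definition proper_fun :: "('a \<Rightarrow> ereal) \<Rightarrow> bool" where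
  "proper_fun h \<longleftrightarrow> (\<forall>x. h x \<noteq> -\<infinity>) \<and> effdom h \<noteq> {}"

definition argmin_set :: "('a \<Rightarrow> ereal) \<Rightarrow> 'a set" where
  "argmin_set h = {x. is_arg_min h (\<lambda>_. True) x}"

(* For x in effdom h all terms on the right-hand side of the inequality are finite,
   so no undetermined ereal operation occurs. *)
definition strongly_quasar_convex ::
    "real \<Rightarrow> real \<Rightarrow> (real ^ 'n \<Rightarrow> ereal) \<Rightarrow> real ^ 'n \<Rightarrow> bool" where
  "strongly_quasar_convex \<kappa> \<gamma> h xbar \<longleftrightarrow>
     0 < \<kappa> \<and> \<kappa> \<le> 1 \<and> 0 \<le> \<gamma> \<and>
     proper_fun h \<and> convex (effdom h) \<and> xbar \<in> argmin_set h \<and>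
     (\<forall>x\<in>effdom h. \<forall>l\<in>{0..1}.
        h (l *\<^sub>R xbar + (1 - l) *\<^sub>R x)
        \<le> ereal (\<kappa> * l) * h xbar + ereal (1 - \<kappa> * l) * h x
           - ereal (l * (1 - l / (2 - \<kappa>)) * (\<kappa> * \<gamma> / 2) * (norm (x - xbar))\<^sup>2))"

definition quasar_convex :: "real \<Rightarrow> (real ^ 'n \<Rightarrow> ereal) \<Rightarrow> real ^ 'n \<Rightarrow> bool" where
  "quasar_convex \<kappa> h xbar \<longleftrightarrow> strongly_quasar_convex \<kappa> 0 h xbar"

definition lower_dini :: "(real ^ 'n \<Rightarrow> ereal) \<Rightarrow> real ^ 'n \<Rightarrow> real ^ 'n \<Rightarrow> ereal" where
  "lower_dini h x d = Liminf (at_right 0) (\<lambda>t. (h (x + t *\<^sub>R d) - h x) / ereal t)"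

definition Dcrit :: "(real ^ 'n \<Rightarrow> ereal) \<Rightarrow> (real ^ 'n) set" where
  "Dcrit h = {x \<in> effdom h. \<forall>d. 0 \<le> lower_dini h x d}"

(* Neighbourhoods are taken in the whole space, so points where h is +\<infinity> are compared too. *)
definition local_minimizer :: "(real ^ 'n \<Rightarrow> ereal) \<Rightarrow> real ^ 'n \<Rightarrow> bool" where
  "local_minimizer h x \<longleftrightarrow> x \<in> effdom h \<and> (\<forall>\<^sub>F y in nhds x. h x \<le> h y)"

definition local_maximizer :: "(real ^ 'n \<Rightarrow> ereal) \<Rightarrow> real ^ 'n \<Rightarrow> bool" where
  "local_maximizer h x \<longleftrightarrow> x \<in> effdom h \<and> (\<forall>\<^sub>F y in nhds x. h y \<le> h x)"

definition dini_saddle_point :: "(real ^ 'n \<Rightarrow> ereal) \<Rightarrow> real ^ 'n \<Rightarrow> bool" where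
  "dini_saddle_point h x \<longleftrightarrow>
     x \<in> Dcrit h \<and> \<not> local_minimizer h x \<and> \<not> local_maximizer h x"

end

theory Submission
  imports Defs
begin

text \<open>
  Let \<open>x\<close> be a point of the effective domain and move from \<open>x\<close> towards the reference minimizer
  \<open>xbar\<close>, that is, in the direction \<open>d = xbar - x\<close>, so that
  \<open>x + t d = t xbar + (1 - t) x\<close>. Dividing the strong quasar-convexity inequality by \<open>t > 0\<close>
  bounds the difference quotient by
  \<open>\<kappa> (h xbar - h x) - (1 - t / (2 - \<kappa>)) (\<kappa> \<gamma> / 2) \<parallel>x - xbar\<parallel>\<^sup>2\<close>. For \<open>t \<le> 1/2\<close> the factor
  \<open>1 - t / (2 - \<kappa>)\<close> is at least \<open>1/2\<close>, since \<open>\<kappa> \<le> 1\<close>, which leaves a bound independent of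
  \<open>t\<close> and hence a bound on the lower Dini derivative (lemma \<open>lower_dini_towards_minimizer\<close>).

  At a stationary point this bound is nonnegative, so
  \<open>h x - h xbar + (\<gamma> / 4) \<parallel>x - xbar\<parallel>\<^sup>2 \<le> 0\<close>. Both terms on the left are nonnegative, hence both
  vanish: \<open>x\<close> is a minimizer, and \<open>x = xbar\<close> if \<open>\<gamma> > 0\<close>
  (lemma \<open>Dcrit_strongly_quasar_convex\<close>). Conversely, minimizers are always stationary.
\<close>

lemma argmin_set_iff: "x \<in> argmin_set h \<longleftrightarrow> (\<forall>y. h x \<le> h y)"
  by (auto simp: argmin_set_def is_arg_min_def not_less)

lemma argmin_set_subset_effdom:
  assumes "proper_fun h"
  shows "argmin_set h \<subseteq> effdom h"
  using assms by (fastforce simp: proper_fun_def effdom_def argmin_set_iff intro: le_less_trans)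

lemma effdom_finiteE:
  assumes "proper_fun h" "x \<in> effdom h"
  obtains r where "h x = ereal r"
  using assms by (cases "h x") (auto simp: proper_fun_def effdom_def)

lemma argmin_set_subset_Dcrit:
  assumes "proper_fun h"
  shows "argmin_set h \<subseteq> Dcrit h"
proof
  fix x assume x: "x \<in> argmin_set h"
  then have dom: "x \<in> effdom h"
    using argmin_set_subset_effdom[OF assms] by blast
  then obtain r where r: "h x = ereal r"
    by (rule effdom_finiteE[OF assms])
  have "0 \<le> lower_dini h x d" for d
    unfolding lower_dini_def
  proof (rule Liminf_bounded)
    show "\<forall>\<^sub>F t in at_right 0. 0 \<le> (h (x + t *\<^sub>R d) - h x) / ereal t"
      unfolding eventually_at_right_field
    proof (intro exI[of _ 1] conjI allI impI)
      fix t :: real assume "0 < t"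
      moreover have "0 \<le> h (x + t *\<^sub>R d) - h x"
        using x r by (simp add: argmin_set_iff ereal_le_minus)
      ultimately show "0 \<le> (h (x + t *\<^sub>R d) - h x) / ereal t"
        by (simp add: zero_le_divide_ereal)
    qed simp
  qed
  with dom show "x \<in> Dcrit h"
    by (simp add: Dcrit_def)
qed

lemma lower_dini_towards_minimizer:
  assumes sqc: "strongly_quasar_convex \<kappa> \<gamma> h xbar"
    and r: "h x = ereal r" and m: "h xbar = ereal m"
  shows "lower_dini h x (xbar - x)
           \<le> ereal (\<kappa> * (m - r) - \<kappa> * \<gamma> / 4 * (norm (x - xbar))\<^sup>2)"
proof -
  define N where "N = (norm (x - xbar))\<^sup>2"
  let ?q = "\<lambda>t. (h (x + t *\<^sub>R (xbar - x)) - h x) / ereal t"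
  have "x \<in> effdom h"
    using r by (simp add: effdom_def)
  with sqc have \<kappa>: "0 < \<kappa>" "\<kappa> \<le> 1" and \<gamma>: "0 \<le> \<gamma>" and proper: "proper_fun h"
    and ineq: "\<And>l. 0 \<le> l \<Longrightarrow> l \<le> 1 \<Longrightarrow> h (l *\<^sub>R xbar + (1 - l) *\<^sub>R x)
        \<le> ereal (\<kappa> * l) * h xbar + ereal (1 - \<kappa> * l) * h x
           - ereal (l * (1 - l / (2 - \<kappa>)) * (\<kappa> * \<gamma> / 2) * (norm (x - xbar))\<^sup>2)"
    by (simp_all add: strongly_quasar_convex_def)
  have ev: "\<forall>\<^sub>F t in at_right 0. ?q t \<le> ereal (\<kappa> * (m - r) - \<kappa> * \<gamma> / 4 * N)"
    unfolding eventually_at_right_field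
  proof (intro exI[of _ "1/2"] conjI allI impI)
    fix t :: real assume t: "0 < t" "t < 1/2"
    define y where "y = x + t *\<^sub>R (xbar - x)"
    have "y = t *\<^sub>R xbar + (1 - t) *\<^sub>R x"
      by (simp add: y_def algebra_simps)
    then have le: "h y \<le> ereal (\<kappa> * t * m + (1 - \<kappa> * t) * r
        - t * (1 - t / (2 - \<kappa>)) * (\<kappa> * \<gamma> / 2) * N)"
      using ineq[of t] t by (simp add: r m N_def)
    then have "y \<in> effdom h"
      by (auto simp: effdom_def intro: le_less_trans)
    then obtain s where s: "h y = ereal s"
      by (rule effdom_finiteE[OF proper])
    have "1/2 \<le> 1 - t / (2 - \<kappa>)"
      using t \<kappa> by (simp add: field_simps)
    moreover have "0 \<le> t * (\<kappa> * \<gamma> / 2 * N)"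
      using t \<kappa> \<gamma> by (simp add: N_def)
    ultimately have "1/2 * (t * (\<kappa> * \<gamma> / 2 * N)) \<le> (1 - t / (2 - \<kappa>)) * (t * (\<kappa> * \<gamma> / 2 * N))"
      by (rule mult_right_mono)
    moreover from le s
    have "s \<le> \<kappa> * t * m + (1 - \<kappa> * t) * r - (1 - t / (2 - \<kappa>)) * (t * (\<kappa> * \<gamma> / 2 * N))"
      by (simp add: mult_ac)
    ultimately have "s \<le> \<kappa> * t * m + (1 - \<kappa> * t) * r - 1/2 * (t * (\<kappa> * \<gamma> / 2 * N))"
      by linarith
    then have "s - r \<le> t * (\<kappa> * (m - r) - \<kappa> * \<gamma> / 4 * N)"
      by (simp add: algebra_simps)
    then have "(s - r) / t \<le> \<kappa> * (m - r) - \<kappa> * \<gamma> / 4 * N"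
      using t by (simp add: pos_divide_le_eq mult.commute)
    then show "?q t \<le> ereal (\<kappa> * (m - r) - \<kappa> * \<gamma> / 4 * N)"
      using s r t by (simp flip: y_def)
  qed simp
  have "Liminf (at_right 0) ?q \<le> Limsup (at_right 0) ?q"
    by (rule Liminf_le_Limsup) simp
  also have "\<dots> \<le> ereal (\<kappa> * (m - r) - \<kappa> * \<gamma> / 4 * N)"
    using ev by (rule Limsup_bounded)
  finally show ?thesis
    by (simp add: lower_dini_def N_def)
qed

lemma Dcrit_strongly_quasar_convex:
  assumes sqc: "strongly_quasar_convex \<kappa> \<gamma> h xbar" and x: "x \<in> Dcrit h"
  shows "x \<in> argmin_set h" and "0 < \<gamma> \<Longrightarrow> x = xbar"
proof -
  from sqc have \<kappa>: "0 < \<kappa>" and \<gamma>: "0 \<le> \<gamma>" and proper: "proper_fun h"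
    and min: "xbar \<in> argmin_set h"
    by (auto simp: strongly_quasar_convex_def)
  obtain r where r: "h x = ereal r"
    using x proper by (auto simp: Dcrit_def elim: effdom_finiteE)
  obtain m where m: "h xbar = ereal m"
    using min proper argmin_set_subset_effdom by (blast elim: effdom_finiteE)
  have "m \<le> r"
    using min r m by (metis argmin_set_iff ereal_less_eq(3))
  have "0 \<le> lower_dini h x (xbar - x)"
    using x by (simp add: Dcrit_def)
  also note lower_dini_towards_minimizer[OF sqc r m]
  finally have "0 \<le> \<kappa> * (m - r - \<gamma> / 4 * (norm (x - xbar))\<^sup>2)"
    by (simp add: algebra_simps)
  then have *: "r - m + \<gamma> / 4 * (norm (x - xbar))\<^sup>2 \<le> 0"
    using \<kappa> by (simp add: zero_le_mult_iff)
  have nonneg: "0 \<le> \<gamma> / 4 * (norm (x - xbar))\<^sup>2"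
    using \<gamma> by simp
  from * nonneg \<open>m \<le> r\<close> have "r = m"
    by linarith
  with r m min show "x \<in> argmin_set h"
    by (simp add: argmin_set_iff)
  assume "0 < \<gamma>"
  from * nonneg \<open>m \<le> r\<close> have "\<gamma> / 4 * (norm (x - xbar))\<^sup>2 = 0"
    by linarith
  with \<open>0 < \<gamma>\<close> show "x = xbar"
    by simp
qed

lemma argmin_set_imp_local_minimizer:
  assumes "proper_fun h" "x \<in> argmin_set h"
  shows "local_minimizer h x"
  using assms(2) argmin_set_subset_effdom[OF assms(1)]
  by (auto simp: local_minimizer_def argmin_set_iff subset_iff)

theorem theorem39:
  fixes h :: "real ^ 'n \<Rightarrow> ereal" and xbar :: "real ^ 'n"
  assumes "proper_fun h" and "xbar \<in> argmin_set h"
  shows "(\<forall>\<kappa>::real. 0 < \<kappa> \<and> \<kappa> \<le> 1 \<and> quasar_convex \<kappa> h xbar \<longrightarrow>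
            Dcrit h \<subseteq> argmin_set h \<and> (\<nexists>x. dini_saddle_point h x)) \<and>
         (\<forall>\<kappa> \<gamma>::real. 0 < \<kappa> \<and> \<kappa> \<le> 1 \<and> 0 < \<gamma> \<and> strongly_quasar_convex \<kappa> \<gamma> h xbar \<longrightarrow>
            Dcrit h = {xbar} \<and> argmin_set h = {xbar})"
proof (intro conjI allI impI; elim conjE)
  fix \<kappa> :: real
  assume "quasar_convex \<kappa> h xbar"
  then show sub: "Dcrit h \<subseteq> argmin_set h"
    by (auto simp: quasar_convex_def intro: Dcrit_strongly_quasar_convex)
  show "\<nexists>x. dini_saddle_point h x"
    using sub argmin_set_imp_local_minimizer[OF assms(1)] by (auto simp: dini_saddle_point_def)
next
  fix \<kappa> \<gamma> :: real
  assume "0 < \<gamma>" "strongly_quasar_convex \<kappa> \<gamma> h xbar"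
  then have "Dcrit h \<subseteq> {xbar}"
    using Dcrit_strongly_quasar_convex(2) by blast
  then show "Dcrit h = {xbar}" "argmin_set h = {xbar}"
    using argmin_set_subset_Dcrit[OF assms(1)] assms(2) by blast+
qed

end
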